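(* Let $\gamma>0$, and let $S_{\overline{\boldsymbol{x}}}$, $S_{\overline{\boldsymbol{x}}}^*$, $\boldsymbol{\psi}$, $\mathcal{U}_Q$, $\mathcal{Q}(\boldsymbol{\psi},\boldsymbol{\psi})$, $F$, $\boldsymbol{y}$, $\overline{R}$ be as in the context. Then the optimization problem $$\min_{\boldsymbol{z}\in\mathbb{R}^{\overline{R}},\,u\in\mathcal{U}_Q}\ \big|[\boldsymbol{\psi},u]-\boldsymbol{z}\big|^2+\gamma\|u\|_{\mathcal{U}_Q}^2\quad\text{s.t. } F(\boldsymbol{z})=\boldsymbol{y}$$ admits a solution $$u^\dagger=(S_{\overline{\boldsymbol{x}}}^*S_{\overline{\boldsymbol{x}}}+\gamma I)^{-1}S_{\overline{\boldsymbol{x}}}^*\boldsymbol{z}^\dagger,$$ where $\boldsymbol{z}^\dagger$ is a solution to $$\min_{\boldsymbol{z}\in\mathbb{R}^{\overline{R}}}\ \boldsymbol{z}^T(\mathcal{Q}(\boldsymbol{\psi},\boldsymbol{\psi})+\gamma I)^{-1}\boldsymbol{z}\quad\text{s.t. } F(\boldsymbol{z})=\boldsymbol{y}.$$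
   Context: Space. $\Omega\subset\mathbb{R}^d$ ($d\geq1$) is a bounded open domain with boundary $\partial\Omega$. $\mathcal{U}$ is a Banach space of real functions on $\overline{\Omega}$ with dual $\mathcal{U}^*$ and duality pairing $[\cdot,\cdot]$ between $\mathcal{U}^*$ and $\mathcal{U}$. There is a linear bijection $\mathcal{K}:\mathcal{U}^*\to\mathcal{U}$ that is symmetric ($[\phi,\mathcal{K}\varphi]=[\varphi,\mathcal{K}\phi]$) and positive ($[\phi,\mathcal{K}\phi]>0$ for $\phi\neq0$), and $\|u\|_{\mathcal{U}}^2=[\mathcal{K}^{-1}u,u]$, with inner product $\langle u,v\rangle=[\mathcal{K}^{-1}u,v]$. $\mathcal{U}$ is the RKHS of $K(\boldsymbol{x},\boldsymbol{x}')=[\delta_{\boldsymbol{x}},\mathcal{K}\delta_{\boldsymbol{x}'}]$, where $\delta_{\boldsymbol{x}}$ is evaluation at $\boldsymbol{x}\in\overline\Omega$. For vectors of functionals $\boldsymbol{\alpha}=(\alpha_i)$, $\boldsymbol{\beta}=(\beta_j)$ in $\mathcal{U}^*$: $[\boldsymbol{\alpha},u]$ is the vector $([\alpha_i,u])_i$, $\mathcal{K}\boldsymbol{\alpha}$ is the vector of functions $(\mathcal{K}\alpha_i)_i$, and $\mathcal{K}(\boldsymbol{\alpha},\boldsymbol{\beta})$ is the matrix with entries $[\alpha_i,\mathcal{K}\beta_j]$ (a single functional is a vector of length one); similarly for $\mathcal{Q}$ below. PDE. $1\leq D_b\leq D$; $L_1,\dots,L_{D_b}:\mathcal{U}\to C(\partial\Omega)$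 and $L_{D_b+1},\dots,L_D:\mathcal{U}\to C(\Omega)$ are bounded linear operators; $P$ (with $D-D_b$ real arguments) and $B$ (with $D_b$ real arguments) represent nonlinear operators; $f,g$ are given data on $\Omega$, $\partial\Omega$. It is assumed that the PDE $P(L_{D_b+1}(u^* )(\boldsymbol{x}),\dots,L_D(u^* )(\boldsymbol{x}))=f(\boldsymbol{x})$ for $\boldsymbol{x}\in\Omega$, $B(L_1(u^* )(\boldsymbol{x}),\dots,L_{D_b}(u^* )(\boldsymbol{x}))=g(\boldsymbol{x})$ for $\boldsymbol{x}\in\partial\Omega$, has a unique strong solution $u^*\in\mathcal{U}$. Inducing points. $\widehat{\boldsymbol{x}}_1,\dots,\widehat{\boldsymbol{x}}_{M_\Omega}\in\Omega$, $\widehat{\boldsymbol{x}}_{M_\Omega+1},\dots,\widehat{\boldsymbol{x}}_M\in\partial\Omega$. $\boldsymbol{\phi}$ is the vector of all functionals $\delta_{\widehat{\boldsymbol{x}}_j}\circ L_i$ with ($1\leq i\leq D_b$, $M_\Omega+1\leq j\leq M$) or ($D_b+1\leq i\leq D$, $1\leq j\leq M_\Omega$); its entries are assumed linearly independent in $\mathcal{U}^*$. Put $\Theta=\mathcal{K}(\boldsymbol{\phi},\boldsymbol{\phi})$ (invertible), and let $\mathcal{Q}:\mathcal{U}^*\to\mathcal{U}$ be given by $[\varphi,\mathcal{Q}\varphi']=\mathcal{K}(\varphi,\boldsymbol{\phi})\Theta^{-1}\mathcal{K}(\boldsymbol{\phi},\varphi')$. $\mathcal{U}_Q\subset\mathcal{U}$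 is the RKHS of the positive semi-definite kernel $Q(\boldsymbol{x},\boldsymbol{x}')=[\delta_{\boldsymbol{x}},\mathcal{Q}\delta_{\boldsymbol{x}'}]$. Samples. $\boldsymbol{x}_1,\dots,\boldsymbol{x}_{N_\Omega}\in\Omega$, $\boldsymbol{x}_{N_\Omega+1},\dots,\boldsymbol{x}_N\in\partial\Omega$, $\overline{\boldsymbol{x}}=\{\boldsymbol{x}_i\}_{i=1}^N$. $\boldsymbol{\psi}$ is the vector, ordered first by $i$ and then by $j$, of the functionals $\psi_j^{(i)}=\delta_{\boldsymbol{x}_j}\circ L_i$ with ($1\leq i\leq D_b$, $N_\Omega+1\leq j\leq N$) or ($D_b+1\leq i\leq D$, $1\leq j\leq N_\Omega$); its length is $\overline{R}=(N-N_\Omega)D_b+N_\Omega(D-D_b)$. Vectors $\boldsymbol{z}\in\mathbb{R}^{\overline{R}}$ are indexed correspondingly as $z_j^{(i)}$. $\boldsymbol{y}\in\mathbb{R}^N$ has $y_j=f(\boldsymbol{x}_j)$ for $j\leq N_\Omega$ and $y_j=g(\boldsymbol{x}_j)$ for $j>N_\Omega$. $F$ is the nonlinear map with $(F(\boldsymbol{z}))_j=P(z_j^{(D_b+1)},\dots,z_j^{(D)})$ for $j\leq N_\Omega$ and $(F(\boldsymbol{z}))_j=B(z_j^{(1)},\dots,z_j^{(D_b)})$ for $N_\Omega<j\leq N$. Sampling operator. $S_{\overline{\boldsymbol{x}}}:\mathcal{U}_Q\to\mathbb{R}^{\overline{R}}$, $S_{\overline{\boldsymbol{x}}}u=[\boldsymbol{\psi},u]$;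 its adjoint (with respect to the inner product of $\mathcal{U}_Q$ and the Euclidean one) is $S_{\overline{\boldsymbol{x}}}^*c=c^T\mathcal{Q}\boldsymbol{\psi}$. $I$ denotes an identity map or matrix; $|\cdot|$ is the Euclidean norm.
   Formalization: For arbitrary P and B it is shown that every solution z† of the reduced problem yields a solution u† of the joint problem; that some z† exists is asserted only for continuous P and B, since without regularity the reduced minimum need not be attained. *)

theory Defs
  imports "HOL-Analysis.Analysis" "Jordan_Normal_Form.Matrix"
begin

unbundle no vec_syntax
unbundle no inner_syntax

text \<open>
  Vectors and matrices of varying size are those of \<^theory>\<open>Jordan_Normal_Form.Matrix\<close>, so
  positions count from 0, whereas the operators \<open>L\<^sub>i\<close> and the points \<open>x\<^sub>j\<close> are indexed from 1.

  A Banach space of real functions on \<open>X\<close> is a type \<open>'u\<close> of class \<^class>\<open>banach\<close> together with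
  an evaluation \<open>ev :: 'u \<Rightarrow> 'a \<Rightarrow> real\<close> under which elements agreeing on \<open>X\<close> are equal;
  its dual is the type \<open>'u \<Rightarrow>\<^sub>L real\<close>, and the duality pairing is application.
\<close>

definition function_space :: "'a set \<Rightarrow> ('u::banach \<Rightarrow> 'a \<Rightarrow> real) \<Rightarrow> bool" where
  "function_space X ev \<longleftrightarrow>
     (\<forall>x\<in>X. bounded_linear (\<lambda>u. ev u x)) \<and>
     (\<forall>u v. (\<forall>x\<in>X. ev u x = ev v x) \<longrightarrow> u = v)"

text \<open>
  \<open>C(S)\<close> carries the topology of uniform convergence on compact subsets of \<open>S\<close>. For compact \<open>S\<close>
  (such as the boundary of a bounded domain) this is the supremum norm; for \<open>S\<close> open,
  boundedness with respect to the supremum norm is a special case.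
\<close>

definition bounded_op_into_C ::
  "'a::topological_space set \<Rightarrow> ('u::real_normed_vector \<Rightarrow> 'a \<Rightarrow> real) \<Rightarrow> bool" where
  "bounded_op_into_C S T \<longleftrightarrow>
     (\<forall>u. continuous_on S (T u)) \<and>
     (\<forall>u v. \<forall>x\<in>S. T (u + v) x = T u x + T v x) \<and>
     (\<forall>c u. \<forall>x\<in>S. T (c *\<^sub>R u) x = c * T u x) \<and>
     (\<forall>X. compact X \<and> X \<subseteq> S \<longrightarrow> (\<exists>C. \<forall>u. \<forall>x\<in>X. \<bar>T u x\<bar> \<le> C * norm u))"

definition complete_inner_product_on ::
  "'u::real_vector set \<Rightarrow> ('u \<Rightarrow> 'u \<Rightarrow> real) \<Rightarrow> bool" where
  "complete_inner_product_on H ip \<longleftrightarrow>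
     (\<forall>u\<in>H. \<forall>v\<in>H. ip u v = ip v u) \<and>
     (\<forall>u\<in>H. \<forall>v\<in>H. \<forall>w\<in>H. ip (u + v) w = ip u w + ip v w) \<and>
     (\<forall>c. \<forall>u\<in>H. \<forall>v\<in>H. ip (c *\<^sub>R u) v = c * ip u v) \<and>
     (\<forall>u\<in>H. u \<noteq> 0 \<longrightarrow> 0 < ip u u) \<and>
     (\<forall>s. (\<forall>n. s n \<in> H) \<and>
          (\<forall>e>0. \<exists>n0::nat. \<forall>m\<ge>n0. \<forall>n\<ge>n0. ip (s m - s n) (s m - s n) < e) \<longrightarrow>
          (\<exists>l\<in>H. (\<lambda>n. ip (s n - l) (s n - l)) \<longlonglongrightarrow> 0))"

text \<open>
  \<open>H\<close> with inner product \<open>ip\<close> is the reproducing kernel Hilbert space of \<open>k\<close> on \<open>X\<close>;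
  \<open>H\<close> and, on \<open>H\<close>, also \<open>ip\<close> are determined by \<open>k\<close> (Moore--Aronszajn).
\<close>

definition is_rkhs ::
  "('u::real_vector \<Rightarrow> 'a \<Rightarrow> real) \<Rightarrow> 'a set \<Rightarrow> ('a \<Rightarrow> 'a \<Rightarrow> real) \<Rightarrow> 'u set \<Rightarrow> ('u \<Rightarrow> 'u \<Rightarrow> real) \<Rightarrow> bool"
  where
  "is_rkhs ev X k H ip \<longleftrightarrow>
     subspace H \<and> complete_inner_product_on H ip \<and>
     (\<forall>x'\<in>X. \<exists>w\<in>H. (\<forall>x\<in>X. ev w x = k x x') \<and> (\<forall>u\<in>H. ip u w = ev u x'))"

definition lin_indep_list :: "'v::real_vector list \<Rightarrow> bool" where
  "lin_indep_list vs \<longleftrightarrow> distinct vs \<and> independent (set vs)"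

text \<open>
  The index pairs \<open>(i, j)\<close> of the functionals \<open>\<delta>\<^bsub>x\<^sub>j\<^esub> \<circ> L\<^sub>i\<close>, ordered first by \<open>i\<close> and then by \<open>j\<close>:
  of \<open>n\<close> points, the first \<open>n\<^sub>\<Omega>\<close> are interior and go with the operators \<open>D\<^sub>b < i \<le> D\<close>, the others
  are boundary points and go with \<open>1 \<le> i \<le> D\<^sub>b\<close>.
\<close>

definition index_pairs :: "nat \<Rightarrow> nat \<Rightarrow> nat \<Rightarrow> nat \<Rightarrow> (nat \<times> nat) list" where
  "index_pairs Db D n\<^sub>\<Omega> n =
     [(i, j). i \<leftarrow> [1..<Db + 1], j \<leftarrow> [n\<^sub>\<Omega> + 1..<n + 1]] @
     [(i, j). i \<leftarrow> [Db + 1..<D + 1], j \<leftarrow> [1..<n\<^sub>\<Omega> + 1]]"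

definition functionals ::
  "(nat \<Rightarrow> 'u::real_normed_vector \<Rightarrow> 'a \<Rightarrow> real) \<Rightarrow> (nat \<Rightarrow> 'a) \<Rightarrow> (nat \<times> nat) list \<Rightarrow>
   ('u \<Rightarrow>\<^sub>L real) list" where
  "functionals L x idx = map (\<lambda>(i, j). Blinfun (\<lambda>u. L i u (x j))) idx"

definition component :: "(nat \<times> nat) list \<Rightarrow> real Matrix.vec \<Rightarrow> nat \<Rightarrow> nat \<Rightarrow> real" where
  "component idx z i j = z $ (THE k. k < length idx \<and> idx ! k = (i, j))"

definition pairing_vec :: "('u::real_normed_vector \<Rightarrow>\<^sub>L real) list \<Rightarrow> 'u \<Rightarrow> real Matrix.vec" where
  "pairing_vec \<alpha> u = Matrix.vec (length \<alpha>) (\<lambda>k. blinfun_apply (\<alpha> ! k) u)"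

text \<open>The matrix \<open>T(\<alpha>, \<beta>)\<close> with entries \<open>[\<alpha>\<^sub>k, T \<beta>\<^sub>l]\<close>.\<close>

definition op_matrix ::
  "(('u::real_normed_vector \<Rightarrow>\<^sub>L real) \<Rightarrow> 'u) \<Rightarrow> ('u \<Rightarrow>\<^sub>L real) list \<Rightarrow> ('u \<Rightarrow>\<^sub>L real) list \<Rightarrow>
   real Matrix.mat" where
  "op_matrix T \<alpha> \<beta> =
     Matrix.mat (length \<alpha>) (length \<beta>) (\<lambda>(k, l). blinfun_apply (\<alpha> ! k) (T (\<beta> ! l)))"

definition mat_inv :: "real Matrix.mat \<Rightarrow> real Matrix.mat" where
  "mat_inv A = (THE B. B \<in> carrier_mat (dim_row A) (dim_row A) \<and> inverts_mat A B \<and> inverts_mat B A)"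

text \<open>
  The operator given by \<open>[\<phi>, Q \<phi>'] = K(\<phi>, \<Phi>) \<Theta>\<^sup>-\<^sup>1 K(\<Phi>, \<phi>')\<close> for all functionals \<open>\<phi>\<close>,
  where \<open>\<Theta> = K(\<Phi>, \<Phi>)\<close>.
\<close>

definition inducing_operator ::
  "(('u::real_normed_vector \<Rightarrow>\<^sub>L real) \<Rightarrow> 'u) \<Rightarrow> ('u \<Rightarrow>\<^sub>L real) list \<Rightarrow> ('u \<Rightarrow>\<^sub>L real) \<Rightarrow> 'u" where
  "inducing_operator K \<Phi> \<phi>' =
     (THE w. \<forall>\<phi>. blinfun_apply \<phi> w =
        (op_matrix K [\<phi>] \<Phi> * mat_inv (op_matrix K \<Phi> \<Phi>) * op_matrix K \<Phi> [\<phi>']) $$ (0, 0))"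

text \<open>
  The adjoint of \<open>S :: H \<rightarrow> \<real>\<^sup>R\<close> with respect to the inner product \<open>ip\<close> on \<open>H\<close>
  and the Euclidean one.
\<close>

definition adjoint_on ::
  "'u set \<Rightarrow> ('u \<Rightarrow> 'u \<Rightarrow> real) \<Rightarrow> ('u \<Rightarrow> real Matrix.vec) \<Rightarrow> real Matrix.vec \<Rightarrow> 'u" where
  "adjoint_on H ip S c = (THE w. w \<in> H \<and> (\<forall>u\<in>H. ip w u = c \<bullet> S u))"

text \<open>The vectors \<open>(L\<^sub>l\<^sub>o\<^sub>+\<^sub>1(u)(x), \<dots>, L\<^sub>h\<^sub>i(u)(x))\<close> and \<open>(z\<^sub>j\<^bsup>(lo+1)\<^esup>, \<dots>, z\<^sub>j\<^bsup>(hi)\<^esup>)\<close>.\<close>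

definition op_values ::
  "(nat \<Rightarrow> 'u \<Rightarrow> 'a \<Rightarrow> real) \<Rightarrow> nat \<Rightarrow> nat \<Rightarrow> 'u \<Rightarrow> 'a \<Rightarrow> real Matrix.vec" where
  "op_values L lo hi u x = Matrix.vec (hi - lo) (\<lambda>l. L (lo + 1 + l) u x)"

definition component_values ::
  "(nat \<times> nat) list \<Rightarrow> nat \<Rightarrow> nat \<Rightarrow> real Matrix.vec \<Rightarrow> nat \<Rightarrow> real Matrix.vec" where
  "component_values idx lo hi z j = Matrix.vec (hi - lo) (\<lambda>l. component idx z (lo + 1 + l) j)"

definition strong_solution ::
  "'a::topological_space set \<Rightarrow> (nat \<Rightarrow> 'u \<Rightarrow> 'a \<Rightarrow> real) \<Rightarrow> nat \<Rightarrow> nat \<Rightarrow>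
   (real Matrix.vec \<Rightarrow> real) \<Rightarrow> (real Matrix.vec \<Rightarrow> real) \<Rightarrow> ('a \<Rightarrow> real) \<Rightarrow> ('a \<Rightarrow> real) \<Rightarrow> 'u \<Rightarrow> bool"
  where
  "strong_solution \<Omega> L Db D P B f g u \<longleftrightarrow>
     (\<forall>x\<in>\<Omega>. P (op_values L Db D u x) = f x) \<and>
     (\<forall>x\<in>frontier \<Omega>. B (op_values L 0 Db u x) = g x)"

definition constraint_map ::
  "nat \<Rightarrow> nat \<Rightarrow> nat \<Rightarrow> nat \<Rightarrow> (real Matrix.vec \<Rightarrow> real) \<Rightarrow> (real Matrix.vec \<Rightarrow> real) \<Rightarrow>
   real Matrix.vec \<Rightarrow> real Matrix.vec" where
  "constraint_map Db D n\<^sub>\<Omega> n P B z =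
     (let idx = index_pairs Db D n\<^sub>\<Omega> n
      in Matrix.vec n (\<lambda>k. if k < n\<^sub>\<Omega> then P (component_values idx Db D z (k + 1))
                          else B (component_values idx 0 Db z (k + 1))))"

definition data_vec ::
  "('a \<Rightarrow> real) \<Rightarrow> ('a \<Rightarrow> real) \<Rightarrow> (nat \<Rightarrow> 'a) \<Rightarrow> nat \<Rightarrow> nat \<Rightarrow> real Matrix.vec" where
  "data_vec f g x n\<^sub>\<Omega> n =
     Matrix.vec n (\<lambda>k. if k < n\<^sub>\<Omega> then f (x (k + 1)) else g (x (k + 1)))"

text \<open>
  Continuity on \<open>\<real>\<^sup>m\<close>: functions on \<^typ>\<open>nat \<Rightarrow> real\<close> carry the product topology, and the
  composite below depends on the first \<open>m\<close> coordinates only.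
\<close>

definition continuous_on_vecs :: "nat \<Rightarrow> (real Matrix.vec \<Rightarrow> real) \<Rightarrow> bool" where
  "continuous_on_vecs m G \<longleftrightarrow> continuous_on UNIV (\<lambda>a :: nat \<Rightarrow> real. G (Matrix.vec m a))"

end

theory Submission
  imports Defs "Jordan_Normal_Form.Determinant"
begin

text \<open>
  \<open>U\<^sub>Q\<close> turns out to be the span of the functions \<open>K \<Phi>\<^sub>k\<close>, on which \<open>\<langle>u, Q \<phi>\<rangle> = [\<phi>, u]\<close> for every functional
  \<open>\<phi>\<close>. Hence \<open>S\<^sup>* c = \<Sum>\<^sub>k c\<^sub>k Q \<psi>\<^sub>k\<close> and \<open>S S\<^sup>* = Q(\<psi>, \<psi>)\<close>, so \<open>A = S S\<^sup>* + \<gamma> I\<close> is positive definite and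
  \<open>(S\<^sup>* S + \<gamma> I)\<^sup>-\<^sup>1 S\<^sup>* = S\<^sup>* A\<^sup>-\<^sup>1\<close>. For fixed \<open>z\<close>, completing the square shows that \<open>u = S\<^sup>* A\<^sup>-\<^sup>1 z\<close> is
  optimal with value \<open>\<gamma> z\<^sup>T A\<^sup>-\<^sup>1 z\<close>. The reduced problem is coercive with a closed feasible set, which
  contains \<open>S u\<^sup>*\<close>.
\<close>

section \<open>Inverses of matrices with trivial kernel\<close>

text \<open>\<open>mat_inv\<close> is a definite description, so its value is accessible only
  through uniqueness of two-sided inverses: C = C (A B) = (C A) B = B.\<close>

lemma mat_inv_unique:
  assumes A: "A \<in> carrier_mat n n" and B: "B \<in> carrier_mat n n"
    and AB: "A * B = 1\<^sub>m n" and BA: "B * A = 1\<^sub>m n"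
  shows "mat_inv A = B"
proof -
  have eq: "C = B" if C: "C \<in> carrier_mat n n" "C * A = 1\<^sub>m n" for C
  proof -
    have "C = C * (A * B)" using C A B AB by simp
    also have "\<dots> = (C * A) * B" using C A B by (metis assoc_mult_mat)
    finally show ?thesis using C B by simp
  qed
  show ?thesis
    unfolding mat_inv_def
  proof (rule the_equality)
    show "B \<in> carrier_mat (dim_row A) (dim_row A) \<and> inverts_mat A B \<and> inverts_mat B A"
      using A B AB BA by (simp add: inverts_mat_def)
  next
    fix C assume "C \<in> carrier_mat (dim_row A) (dim_row A) \<and> inverts_mat A C \<and> inverts_mat C A"
    then show "C = B"
      using A by (intro eq) (auto simp: inverts_mat_def)
  qed
qed

text \<open>A trivial kernel gives a nonzero determinant, hence a unit of the matrix ring. The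
  kernel form of the hypothesis suits the two applications, the Gram matrix of the inducing
  functionals and S S* + \<gamma> I, whose quadratic forms are positive definite.\<close>

lemma
  assumes A: "A \<in> carrier_mat n n"
    and inj: "\<And>v. v \<in> carrier_vec n \<Longrightarrow> A *\<^sub>v v = 0\<^sub>v n \<Longrightarrow> v = 0\<^sub>v n"
  shows mat_inv_carrier: "mat_inv A \<in> carrier_mat n n"
    and mult_mat_inv: "A * mat_inv A = 1\<^sub>m n"
    and mat_inv_mult: "mat_inv A * A = 1\<^sub>m n"
    and invertible_mat_if_trivial_kernel: "invertible_mat A"
proof -
  have "det A \<noteq> 0"
    using inj by (auto simp: det_0_iff_vec_prod_zero[OF A])
  from det_non_zero_imp_unit[OF A this, of "()"] obtain B
    where B: "B \<in> carrier_mat n n" "A * B = 1\<^sub>m n" "B * A = 1\<^sub>m n"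
    by (auto simp: Units_def ring_mat_def)
  then show "mat_inv A \<in> carrier_mat n n" "A * mat_inv A = 1\<^sub>m n" "mat_inv A * A = 1\<^sub>m n"
    using mat_inv_unique[OF A] by auto
  show "invertible_mat A"
    using A B by (auto simp: invertible_mat_def inverts_mat_def)
qed

text \<open>Transposing both inverse identities makes the transpose a two-sided inverse of the same
  matrix, and inverses are unique.\<close>

lemma mat_inv_symmetric:
  assumes A: "A \<in> carrier_mat n n"
    and inj: "\<And>v. v \<in> carrier_vec n \<Longrightarrow> A *\<^sub>v v = 0\<^sub>v n \<Longrightarrow> v = 0\<^sub>v n"
    and sym: "A\<^sup>T = A"
  shows "(mat_inv A)\<^sup>T = mat_inv A"
proof -
  note inv = mat_inv_carrier[OF A inj] mult_mat_inv[OF A inj] mat_inv_mult[OF A inj]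
  have "A * (mat_inv A)\<^sup>T = (mat_inv A * A)\<^sup>T" "(mat_inv A)\<^sup>T * A = (A * mat_inv A)\<^sup>T"
    using A inv(1) sym by (simp_all add: transpose_mult[OF inv(1) A] transpose_mult[OF A inv(1)])
  with inv have "A * (mat_inv A)\<^sup>T = 1\<^sub>m n" "(mat_inv A)\<^sup>T * A = 1\<^sub>m n"
    by simp_all
  then show ?thesis
    using mat_inv_unique[OF A] inv(1) by (metis transpose_carrier_mat)
qed

section \<open>Linear independence and linear functionals\<close>

text \<open>Distinctness makes positions and members correspond bijectively, so coefficients indexed
  by position become coefficients on the set, where \<open>independent\<close> applies.\<close>

lemma lin_indep_list_scalars_zero:
  assumes indep: "lin_indep_list vs" and sum: "(\<Sum>k<length vs. c k *\<^sub>R (vs ! k)) = 0"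
    and "k < length vs"
  shows "c k = 0"
proof -
  have bij: "bij_betw (nth vs) {..<length vs} (set vs)"
    using indep by (intro bij_betw_nth) (auto simp: lin_indep_list_def)
  define i where "i = the_inv_into {..<length vs} (nth vs)"
  have i: "i (vs ! l) = l" if "l < length vs" for l
    unfolding i_def using bij that by (intro the_inv_into_f_f) (auto simp: bij_betw_def)
  have "(\<Sum>v\<in>set vs. c (i v) *\<^sub>R v) = (\<Sum>k<length vs. c (i (vs ! k)) *\<^sub>R (vs ! k))"
    by (rule sum.reindex_bij_betw[OF bij, symmetric])
  also have "\<dots> = 0"
    using sum by (simp add: i)
  finally have "c (i (vs ! k)) = 0"
    using indep \<open>k < length vs\<close>
    by (intro independentD[of "set vs" "set vs" "\<lambda>v. c (i v)"]) (auto simp: lin_indep_list_def)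
  then show ?thesis using i assms by simp
qed

text \<open>A basis of \<open>H\<close> stays independent when \<open>w\<close> is added, so the
  values 0 on the basis and 1 at \<open>w\<close> extend linearly. The functional may be unbounded,
  which is why \<open>representer\<close> below accepts arbitrary functions.\<close>

lemma linear_functional_vanishing_on_subspace:
  fixes H :: "'v::real_vector set"
  assumes "subspace H" "w \<notin> H"
  shows "\<exists>f :: 'v \<Rightarrow> real. linear f \<and> (\<forall>u\<in>H. f u = 0) \<and> f w = 1"
proof -
  obtain C where C: "C \<subseteq> H" "independent C" "H \<subseteq> span C"
    using maximal_independent_subset[of H] by auto
  have "span C \<subseteq> H" using C(1) assms(1) by (rule span_minimal)
  then have w: "w \<notin> span C" using assms(2) by blast
  then have "independent (insert w C)" using C(2) by (simp add: independent_insert)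
  then obtain f :: "'v \<Rightarrow> real" where f: "linear f" "\<forall>v\<in>insert w C. f v = of_bool (v = w)"
    using linear_independent_extend[of "insert w C" "\<lambda>v. of_bool (v = w) :: real"] by blast
  have "f v = 0" if "v \<in> C" for v
    using f(2) w that span_base[of v C] by (cases "v = w") auto
  then have "f u = 0" if "u \<in> H" for u
    using linear_eq_0_on_span[OF f(1)] C(3) that by blast
  with f show ?thesis by (intro exI[of _ f]) auto
qed

lemma linear_blinfun_apply: "linear (blinfun_apply \<phi>)"
  by (simp add: bounded_linear.linear blinfun.bounded_linear_right)

section \<open>Inner products on a subspace\<close>

locale inner_product_subspace =
  fixes H :: "'u::real_vector set" and ip :: "'u \<Rightarrow> 'u \<Rightarrow> real"
  assumes subspace: "subspace H" and complete: "complete_inner_product_on H ip"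
begin

lemma ip_sym: "u \<in> H \<Longrightarrow> v \<in> H \<Longrightarrow> ip u v = ip v u"
  using complete unfolding complete_inner_product_on_def by blast

lemma ip_add_left: "u \<in> H \<Longrightarrow> v \<in> H \<Longrightarrow> w \<in> H \<Longrightarrow> ip (u + v) w = ip u w + ip v w"
  using complete unfolding complete_inner_product_on_def by blast

lemma ip_scale_left: "u \<in> H \<Longrightarrow> v \<in> H \<Longrightarrow> ip (c *\<^sub>R u) v = c * ip u v"
  using complete unfolding complete_inner_product_on_def by blast

lemma ip_pos: "u \<in> H \<Longrightarrow> u \<noteq> 0 \<Longrightarrow> ip u u > 0"
  using complete unfolding complete_inner_product_on_def by blast

lemma ip_zero_left: "v \<in> H \<Longrightarrow> ip 0 v = 0"
  using ip_scale_left[of v v 0] by simp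

lemma ip_nonneg: "u \<in> H \<Longrightarrow> ip u u \<ge> 0"
  using ip_pos[of u] ip_zero_left[of u] by (cases "u = 0") auto

lemma ip_add_right: "u \<in> H \<Longrightarrow> v \<in> H \<Longrightarrow> w \<in> H \<Longrightarrow> ip w (u + v) = ip w u + ip w v"
  using ip_add_left[of u v w] ip_sym subspace_add[OF subspace, of u v] by simp

lemma ip_sum_left:
  assumes "\<And>i. i \<in> I \<Longrightarrow> s i \<in> H" "v \<in> H"
  shows "ip (\<Sum>i\<in>I. c i *\<^sub>R s i) v = (\<Sum>i\<in>I. c i * ip (s i) v)"
  using assms(1)
proof (induction I rule: infinite_finite_induct)
  case (insert i I)
  have "(\<Sum>i\<in>I. c i *\<^sub>R s i) \<in> H" "c i *\<^sub>R s i \<in> H"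
    using insert.prems by (auto intro!: subspace_sum[OF subspace] subspace_scale[OF subspace])
  then show ?case
    using insert assms(2) by (simp add: ip_add_left ip_scale_left)
qed (simp_all add: ip_zero_left assms(2))

lemma ip_sum_right:
  assumes "\<And>i. i \<in> I \<Longrightarrow> s i \<in> H" "v \<in> H"
  shows "ip v (\<Sum>i\<in>I. c i *\<^sub>R s i) = (\<Sum>i\<in>I. c i * ip v (s i))"
proof -
  have "(\<Sum>i\<in>I. c i *\<^sub>R s i) \<in> H"
    using assms(1) by (auto intro!: subspace_sum[OF subspace] subspace_scale[OF subspace])
  then have "ip v (\<Sum>i\<in>I. c i *\<^sub>R s i) = (\<Sum>i\<in>I. c i * ip (s i) v)"
    using assms by (simp add: ip_sym[of v] ip_sum_left)
  then show ?thesis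
    using assms by (simp add: ip_sym[of v])
qed

lemma ip_extensional:
  assumes "u \<in> H" "v \<in> H" "\<And>w. w \<in> H \<Longrightarrow> ip u w = ip v w"
  shows "u = v"
proof (rule ccontr)
  assume "u \<noteq> v"
  have "u - v \<in> H" "(-1) *\<^sub>R v \<in> H"
    using assms subspace_diff[OF subspace] subspace_scale[OF subspace] by blast+
  \<comment> \<open>The linearity axioms for \<open>ip\<close> speak of sums and scalar multiples,
    so the difference is rewritten in these terms before testing against \<open>u - v\<close>
    itself.\<close>
  moreover have "u - v = u + (-1) *\<^sub>R v" by simp
  ultimately have "ip (u - v) (u - v) = ip u (u - v) + (-1) * ip v (u - v)"
    using assms by (metis ip_add_left ip_scale_left)
  with ip_pos[OF \<open>u - v \<in> H\<close>] assms(3)[OF \<open>u - v \<in> H\<close>] \<open>u \<noteq> v\<close> show False by simp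
qed

end

section \<open>The inducing operator and its reproducing kernel space\<close>

locale inducing =
  fixes K :: "('u::banach \<Rightarrow>\<^sub>L real) \<Rightarrow> 'u" and \<Phi> :: "('u \<Rightarrow>\<^sub>L real) list"
  assumes K_linear: "linear K" and K_surj: "surj K"
    and K_sym: "\<And>\<phi> \<phi>'. blinfun_apply \<phi> (K \<phi>') = blinfun_apply \<phi>' (K \<phi>)"
    and K_pos: "\<And>\<phi>. \<phi> \<noteq> 0 \<Longrightarrow> blinfun_apply \<phi> (K \<phi>) > 0"
    and indep: "lin_indep_list \<Phi>"
begin

abbreviation "\<Theta> \<equiv> op_matrix K \<Phi> \<Phi>"

abbreviation "\<Theta>inv k l \<equiv> mat_inv \<Theta> $$ (k, l)"

text \<open>
  If \<open>f\<close> is linear, this is the element of \<open>span {K \<Phi>\<^sub>k}\<close> that represents \<open>f\<close> on that span with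
  respect to the inner product of \<open>\<U>\<close>; it equals \<open>Q f\<close> when \<open>f\<close> is a bounded functional.
\<close>

definition representer :: "('u \<Rightarrow> real) \<Rightarrow> 'u" where
  "representer f =
     (\<Sum>k<length \<Phi>. \<Sum>l<length \<Phi>. (\<Theta>inv k l * f (K (\<Phi> ! l))) *\<^sub>R K (\<Phi> ! k))"

text \<open>Writing \<open>u - v = K \<phi>\<close> and testing against this same
  \<open>\<phi>\<close>, positivity forces \<open>\<phi> = 0\<close>. This gives uniqueness in the
  definite description \<open>inducing_operator\<close>.\<close>

lemma dual_separates_points:
  assumes "\<And>\<phi> :: 'u \<Rightarrow>\<^sub>L real. blinfun_apply \<phi> u = blinfun_apply \<phi> v"
  shows "u = v"
proof -
  obtain \<phi> where \<phi>: "u - v = K \<phi>" using K_surj by blast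
  have "blinfun_apply \<phi> (K \<phi>) = 0"
    using assms[of \<phi>] by (simp add: blinfun.diff_right flip: \<phi>)
  then have "\<phi> = 0" using K_pos[of \<phi>] by auto
  then show ?thesis using \<phi> linear_0[OF K_linear] by simp
qed

lemma gram_carrier: "\<Theta> \<in> carrier_mat (length \<Phi>) (length \<Phi>)"
  by (simp add: op_matrix_def)

text \<open>For \<open>\<phi>\<close> the combination of the \<Phi>_k with coefficients
  \<open>v\<close>, the form v^T \<Theta> v equals [\<phi>, K \<phi>]. Positivity of
  \<open>K\<close> gives \<open>\<phi> = 0\<close>, and independence gives
  \<open>v = 0\<close>.\<close>

lemma gram_trivial_kernel:
  assumes v: "v \<in> carrier_vec (length \<Phi>)" and "\<Theta> *\<^sub>v v = 0\<^sub>v (length \<Phi>)"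
  shows "v = 0\<^sub>v (length \<Phi>)"
proof -
  define \<phi> where "\<phi> = (\<Sum>k<length \<Phi>. (v $ k) *\<^sub>R (\<Phi> ! k))"
  have zero: "(\<Sum>l<length \<Phi>. blinfun_apply (\<Phi> ! k) (K (\<Phi> ! l)) * v $ l) = 0" if "k < length \<Phi>" for k
    using arg_cong[OF assms(2), of "\<lambda>w. w $ k"] v that
    by (simp add: op_matrix_def scalar_prod_def atLeast0LessThan)
  have K\<phi>: "K \<phi> = (\<Sum>l<length \<Phi>. (v $ l) *\<^sub>R K (\<Phi> ! l))"
    by (simp add: \<phi>_def linear_sum[OF K_linear] linear_cmul[OF K_linear])
  have "blinfun_apply \<phi> (K \<phi>) = (\<Sum>k<length \<Phi>. v $ k * blinfun_apply (\<Phi> ! k) (K \<phi>))"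
    by (simp add: \<phi>_def blinfun.sum_left blinfun.scaleR_left)
  also have "\<dots> = 0"
    using zero by (simp add: K\<phi> blinfun.sum_right blinfun.scaleR_right mult.commute)
  finally have "\<phi> = 0" using K_pos[of \<phi>] by auto
  then show ?thesis
    using lin_indep_list_scalars_zero[OF indep, of "vec_index v"] v
    by (intro eq_vecI) (auto simp: \<phi>_def)
qed

lemma gram_inv_carrier: "mat_inv \<Theta> \<in> carrier_mat (length \<Phi>) (length \<Phi>)"
  using mat_inv_carrier[OF gram_carrier] gram_trivial_kernel by blast

lemma gram_inv_sym:
  assumes "k < length \<Phi>" "l < length \<Phi>"
  shows "\<Theta>inv k l = \<Theta>inv l k"
proof -
  have "\<Theta>\<^sup>T = \<Theta>" by (intro eq_matI) (auto simp: op_matrix_def K_sym)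
  from mat_inv_symmetric[OF gram_carrier gram_trivial_kernel this]
  have "(mat_inv \<Theta>)\<^sup>T = mat_inv \<Theta>" by simp
  then show ?thesis
    using assms gram_inv_carrier by (metis carrier_matD index_transpose_mat(1))
qed

lemma gram_mult_inv:
  assumes "m < length \<Phi>" "l < length \<Phi>"
  shows "(\<Sum>k<length \<Phi>. blinfun_apply (\<Phi> ! m) (K (\<Phi> ! k)) * \<Theta>inv k l) = of_bool (m = l)"
proof -
  have "\<Theta> * mat_inv \<Theta> = 1\<^sub>m (length \<Phi>)"
    by (rule mult_mat_inv[OF gram_carrier gram_trivial_kernel])
  then have "(\<Theta> * mat_inv \<Theta>) $$ (m, l) = of_bool (m = l)"
    using assms by simp
  then show ?thesis
    using assms gram_inv_carrier
    by (simp add: op_matrix_def scalar_prod_def atLeast0LessThan)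
qed

lemma apply_representer:
  assumes "linear h"
  shows "h (representer f) =
    (\<Sum>k<length \<Phi>. \<Sum>l<length \<Phi>. \<Theta>inv k l * f (K (\<Phi> ! l)) * h (K (\<Phi> ! k)))"
  by (simp add: representer_def linear_sum[OF assms] linear_cmul[OF assms])

text \<open>Summing over \<open>k\<close> first produces the entries of \<Theta> \<Theta>^-1, so
  only the term \<open>l = m\<close> survives. Linearity of \<open>f\<close> does not enter.\<close>

lemma representer_interpolates:
  assumes "m < length \<Phi>"
  shows "blinfun_apply (\<Phi> ! m) (representer f) = f (K (\<Phi> ! m))"
proof -
  have "blinfun_apply (\<Phi> ! m) (representer f) =
    (\<Sum>l<length \<Phi>. \<Sum>k<length \<Phi>. \<Theta>inv k l * f (K (\<Phi> ! l)) * blinfun_apply (\<Phi> ! m) (K (\<Phi> ! k)))"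
    unfolding apply_representer[OF linear_blinfun_apply] by (rule sum.swap)
  also have "\<dots> = (\<Sum>l<length \<Phi>. if l = m then f (K (\<Phi> ! l)) else 0)"
  proof (intro sum.cong refl)
    fix l assume "l \<in> {..<length \<Phi>}"
    then have "(\<Sum>k<length \<Phi>. blinfun_apply (\<Phi> ! m) (K (\<Phi> ! k)) * \<Theta>inv k l) * f (K (\<Phi> ! l)) =
        (if l = m then f (K (\<Phi> ! l)) else 0)"
      using gram_mult_inv[OF assms, of l] by auto
    then show "(\<Sum>k<length \<Phi>. \<Theta>inv k l * f (K (\<Phi> ! l)) * blinfun_apply (\<Phi> ! m) (K (\<Phi> ! k))) =
        (if l = m then f (K (\<Phi> ! l)) else 0)"
      unfolding sum_distrib_right by (simp only: mult_ac)
  qed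
  also have "\<dots> = f (K (\<Phi> ! m))"
    using assms by simp
  finally show ?thesis .
qed

lemma gram_inv_form_sym:
  "(\<Sum>k<length \<Phi>. \<Sum>l<length \<Phi>. \<Theta>inv k l * a l * b k) =
   (\<Sum>k<length \<Phi>. \<Sum>l<length \<Phi>. \<Theta>inv k l * b l * a k)"
proof (subst sum.swap, intro sum.cong refl)
  fix k l assume "k \<in> {..<length \<Phi>}" "l \<in> {..<length \<Phi>}"
  then show "\<Theta>inv l k * a k * b l = \<Theta>inv k l * b l * a k"
    using gram_inv_sym[of k l] by simp
qed

text \<open>Both sides are the symmetric bilinear form of \<Theta>^-1 evaluated at the value vectors
  of \<open>f\<close> and \<open>h\<close> on the functions K \<Phi>_k.\<close>

lemma representer_sym:
  assumes "linear f" "linear h"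
  shows "h (representer f) = f (representer h)"
  unfolding apply_representer[OF assms(1)] apply_representer[OF assms(2)]
  by (rule gram_inv_form_sym)

text \<open>Expanding the matrix product and moving \<open>\<phi>\<close> across \<open>K\<close> by
  symmetry yields the pairing with the representer for every test functional; separation by the dual
  then identifies the described element.\<close>

lemma inducing_operator_eq_representer:
  "inducing_operator K \<Phi> \<phi> = representer (blinfun_apply \<phi>)"
proof -
  have "(op_matrix K [\<chi>] \<Phi> * mat_inv \<Theta> * op_matrix K \<Phi> [\<phi>]) $$ (0, 0) =
      blinfun_apply \<chi> (representer (blinfun_apply \<phi>))" for \<chi>
  proof -
    have "(op_matrix K [\<chi>] \<Phi> * mat_inv \<Theta> * op_matrix K \<Phi> [\<phi>]) $$ (0, 0) =
      (\<Sum>l<length \<Phi>. (\<Sum>k<length \<Phi>. blinfun_apply \<chi> (K (\<Phi> ! k)) * \<Theta>inv k l) *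
         blinfun_apply (\<Phi> ! l) (K \<phi>))"
      using gram_inv_carrier
      by (simp add: op_matrix_def scalar_prod_def atLeast0LessThan)
    also have "\<dots> = blinfun_apply \<chi> (representer (blinfun_apply \<phi>))"
      unfolding apply_representer[OF linear_blinfun_apply] K_sym[of \<phi>]
      unfolding sum_distrib_right by (subst sum.swap) (simp only: mult_ac)
    finally show ?thesis .
  qed
  then show ?thesis
    unfolding inducing_operator_def
    by (intro the_equality dual_separates_points) auto
qed


text \<open>
  \<open>U\<^sub>Q\<close> is \<open>span {K \<Phi>\<^sub>k}\<close> with the inner product of \<open>\<U>\<close>. If \<open>K \<Phi>\<^sub>m \<notin> U\<^sub>Q\<close>, a linear \<open>f\<close> vanishing on
  \<open>U\<^sub>Q\<close> but not at \<open>K \<Phi>\<^sub>m\<close> has a representer whose value at every \<open>p\<close> is \<open>f (Q \<delta>\<^sub>p) = 0\<close>.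
  Conversely, the representer of \<open>ip u\<close> agrees with \<open>u\<close> pointwise for every \<open>u \<in> U\<^sub>Q\<close>.
\<close>

lemma
  fixes ev :: "'u \<Rightarrow> 'a \<Rightarrow> real"
  assumes space: "function_space X ev"
    and rkhs: "is_rkhs ev X (\<lambda>p p'. blinfun_apply (Blinfun (\<lambda>u. ev u p))
          (inducing_operator K \<Phi> (Blinfun (\<lambda>u. ev u p')))) H ip"
  shows inducing_operator_in_rkhs: "inducing_operator K \<Phi> \<phi> \<in> H"
    and inducing_operator_reproducing: "u \<in> H \<Longrightarrow> ip u (inducing_operator K \<Phi> \<phi>) = blinfun_apply \<phi> u"
proof -
  let ?Q = "inducing_operator K \<Phi>" and ?\<delta> = "\<lambda>p. Blinfun (\<lambda>u. ev u p)"
  interpret inner_product_subspace H ip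
    using rkhs unfolding is_rkhs_def by unfold_locales auto
  have \<delta>: "blinfun_apply (?\<delta> p) u = ev u p" if "p \<in> X" for p u
    using space that by (simp add: function_space_def bounded_linear_Blinfun_apply)
  have ext: "u = v" if "\<And>p. p \<in> X \<Longrightarrow> ev u p = ev v p" for u v
    using space that unfolding function_space_def by blast
  \<comment> \<open>\<open>is_rkhs\<close> specifies a kernel section only by its values on
    \<open>X\<close>; since points of \<open>X\<close> separate elements, the section is Q
    \<delta>_p itself.\<close>
  have Q\<delta>: "?Q (?\<delta> p) \<in> H \<and> (\<forall>u\<in>H. ip u (?Q (?\<delta> p)) = ev u p)" if p: "p \<in> X" for p
  proof -
    obtain w where w: "w \<in> H" "\<forall>p'\<in>X. ev w p' = blinfun_apply (?\<delta> p') (?Q (?\<delta> p))"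
      "\<forall>u\<in>H. ip u w = ev u p"
      using rkhs p unfolding is_rkhs_def by blast
    then have "w = ?Q (?\<delta> p)" by (intro ext) (simp add: \<delta>)
    with w show ?thesis by simp
  qed
  have ev_representer: "ev (representer f) p = f (?Q (?\<delta> p))" if "linear f" "p \<in> X" for f p
    using representer_sym[OF that(1) linear_blinfun_apply] \<delta>[OF that(2)]
    by (metis inducing_operator_eq_representer)
  have K\<Phi>: "K (\<Phi> ! m) \<in> H" if m: "m < length \<Phi>" for m
  proof (rule ccontr)
    assume "K (\<Phi> ! m) \<notin> H"
    then obtain f :: "'u \<Rightarrow> real" where f: "linear f" "\<forall>u\<in>H. f u = 0" "f (K (\<Phi> ! m)) = 1"
      using linear_functional_vanishing_on_subspace[OF subspace] by blast
    have "representer f = 0"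
    proof (rule ext)
      fix p assume p: "p \<in> X"
      have "ev (representer f) p = 0"
        using f(2) Q\<delta>[OF p] ev_representer[OF f(1) p] by simp
      then show "ev (representer f) p = ev 0 p"
        using \<delta>[OF p, of 0] by simp
    qed
    \<comment> \<open>By interpolation, \<Phi>_m takes the value f (K \<Phi>_m) = 1 on this zero
      representer.\<close>
    with representer_interpolates[OF m, of f] f(3) show False by simp
  qed
  have representer_in: "representer f \<in> H" for f
    unfolding representer_def
    using K\<Phi> by (intro subspace_sum[OF subspace] subspace_scale[OF subspace]) auto
  show "?Q \<phi> \<in> H"
    by (simp add: inducing_operator_eq_representer representer_in)
  \<comment> \<open>\<open>ip u\<close> is known to be linear only on \<open>H\<close>, so
    \<open>representer_sym\<close> cannot be applied to it. Instead Q \<chi> is expanded in the K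
    \<Phi>_k, now known to lie in \<open>H\<close>, and the symmetric form is used directly.\<close>
  have ip_representer: "ip u (?Q \<chi>) = blinfun_apply \<chi> (representer (ip u))" if u: "u \<in> H" for u \<chi>
  proof -
    have "ip u (?Q \<chi>) =
      ip u (\<Sum>k<length \<Phi>. (\<Sum>l<length \<Phi>. \<Theta>inv k l * blinfun_apply \<chi> (K (\<Phi> ! l))) *\<^sub>R K (\<Phi> ! k))"
      by (simp add: inducing_operator_eq_representer representer_def scaleR_sum_left)
    also have "\<dots> = (\<Sum>k<length \<Phi>. \<Sum>l<length \<Phi>.
        \<Theta>inv k l * blinfun_apply \<chi> (K (\<Phi> ! l)) * ip u (K (\<Phi> ! k)))"
      using u K\<Phi> by (subst ip_sum_right) (auto simp: sum_distrib_right)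
    also have "\<dots> = blinfun_apply \<chi> (representer (ip u))"
      unfolding apply_representer[OF linear_blinfun_apply] by (rule gram_inv_form_sym)
    finally show ?thesis .
  qed
  have "representer (ip u) = u" if u: "u \<in> H" for u
  proof (rule ext)
    fix p assume p: "p \<in> X"
    have "ev (representer (ip u)) p = ip u (?Q (?\<delta> p))"
      using ip_representer[OF u, of "?\<delta> p"] p by (simp add: \<delta>)
    then show "ev (representer (ip u)) p = ev u p"
      using Q\<delta>[OF p] u by simp
  qed
  then show "ip u (?Q \<phi>) = blinfun_apply \<phi> u" if "u \<in> H"
    using ip_representer[OF that] that by simp
qed

end

section \<open>Regularized least squares for finitely many represented functionals\<close>

text \<open>The link to the kernel space is reduced to one property: \<open>q \<phi>\<close>
  represents \<open>\<phi>\<close> on \<open>H\<close> for the sampled functionals. \<open>G\<close>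
  is then the Gram matrix of these representers.\<close>

locale ridge = inner_product_subspace H ip
  for H :: "'u::real_normed_vector set" and ip +
  fixes \<psi> :: "('u \<Rightarrow>\<^sub>L real) list" and q :: "('u \<Rightarrow>\<^sub>L real) \<Rightarrow> 'u" and \<gamma> :: real
  assumes q_in: "\<And>\<phi>. \<phi> \<in> set \<psi> \<Longrightarrow> q \<phi> \<in> H"
    and q_repr: "\<And>\<phi> u. \<phi> \<in> set \<psi> \<Longrightarrow> u \<in> H \<Longrightarrow> ip u (q \<phi>) = blinfun_apply \<phi> u"
    and \<gamma>_pos: "\<gamma> > 0"
begin

abbreviation "R \<equiv> length \<psi>"
abbreviation "S \<equiv> pairing_vec \<psi>"
abbreviation "S' \<equiv> adjoint_on H ip S"
abbreviation "G \<equiv> op_matrix q \<psi> \<psi>"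
abbreviation "A \<equiv> G + \<gamma> \<cdot>\<^sub>m 1\<^sub>m R"
abbreviation "T \<equiv> (\<lambda>u. S' (S u) + \<gamma> *\<^sub>R u)"

lemma S_carrier [simp]: "S u \<in> carrier_vec R" "dim_vec (S u) = R"
  by (simp_all add: pairing_vec_def carrier_vecI)

lemma S_add: "S (u + v) = S u + S v"
  by (intro eq_vecI) (simp_all add: pairing_vec_def blinfun.add_right)

lemma S_diff: "S (u - v) = S u - S v"
  by (intro eq_vecI) (simp_all add: pairing_vec_def blinfun.diff_right)

lemma S_scale: "S (c *\<^sub>R u) = c \<cdot>\<^sub>v S u"
  by (intro eq_vecI) (simp_all add: pairing_vec_def blinfun.scaleR_right)

lemma matrix_carrier [simp]: "G \<in> carrier_mat R R" "A \<in> carrier_mat R R"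
  by (simp_all add: op_matrix_def)

lemma matrix_dim [simp]: "dim_row G = R" "dim_col G = R"
  by (simp_all add: op_matrix_def)

lemma G_mult_carrier [simp]: "G *\<^sub>v c \<in> carrier_vec R"
  by (simp add: carrier_vecI)

lemma combination_in: "(\<Sum>k<R. (c $ k) *\<^sub>R q (\<psi> ! k)) \<in> H"
  by (intro subspace_sum[OF subspace] subspace_scale[OF subspace] q_in) auto

lemma ip_combination:
  assumes "u \<in> H"
  shows "ip (\<Sum>k<R. (c $ k) *\<^sub>R q (\<psi> ! k)) u = c \<bullet> S u"
  using assms q_in
  by (subst ip_sum_left) (auto simp: scalar_prod_def pairing_vec_def atLeast0LessThan
      ip_sym[of _ u] q_repr intro!: sum.cong)

text \<open>The combination has the defining property of the adjoint, and inner products against all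
  of \<open>H\<close> determine an element of \<open>H\<close>, so the definite description is
  resolved.\<close>

lemma S'_eq: "S' c = (\<Sum>k<R. (c $ k) *\<^sub>R q (\<psi> ! k))"
  unfolding adjoint_on_def
proof (rule the_equality)
  fix w assume "w \<in> H \<and> (\<forall>u\<in>H. ip w u = c \<bullet> S u)"
  then show "w = (\<Sum>k<R. (c $ k) *\<^sub>R q (\<psi> ! k))"
    by (intro ip_extensional combination_in) (auto simp: ip_combination)
qed (auto simp: combination_in ip_combination)

lemma S'_in: "S' c \<in> H"
  by (simp add: S'_eq combination_in)

lemma ip_S': "u \<in> H \<Longrightarrow> ip (S' c) u = c \<bullet> S u"
  by (simp add: S'_eq ip_combination)

lemma S'_add: "c \<in> carrier_vec R \<Longrightarrow> d \<in> carrier_vec R \<Longrightarrow> S' (c + d) = S' c + S' d"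
  by (simp add: S'_eq scaleR_left_distrib sum.distrib)

lemma S'_scale: "c \<in> carrier_vec R \<Longrightarrow> S' (a \<cdot>\<^sub>v c) = a *\<^sub>R S' c"
  by (simp add: S'_eq scaleR_right.sum)

lemma S_S': "c \<in> carrier_vec R \<Longrightarrow> S (S' c) = G *\<^sub>v c"
  by (intro eq_vecI) (auto simp: pairing_vec_def op_matrix_def S'_eq blinfun.sum_right
      blinfun.scaleR_right scalar_prod_def atLeast0LessThan mult.commute)

lemma A_mult: "c \<in> carrier_vec R \<Longrightarrow> A *\<^sub>v c = G *\<^sub>v c + \<gamma> \<cdot>\<^sub>v c"
  by (intro eq_vecI) (auto simp: add_mult_distrib_mat_vec[of _ R R])

text \<open>Since G = S S', the form c^T G c is the squared \<open>ip\<close>-norm of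
  \<open>S' c\<close>; this makes \<open>G\<close> positive semidefinite and gives coercivity of
  \<open>A\<close>.\<close>

lemma A_quadratic_form:
  assumes c: "c \<in> carrier_vec R"
  shows "c \<bullet> (A *\<^sub>v c) = ip (S' c) (S' c) + \<gamma> * (c \<bullet> c)"
proof -
  have "c \<bullet> (A *\<^sub>v c) = c \<bullet> (G *\<^sub>v c) + \<gamma> * (c \<bullet> c)"
    unfolding A_mult[OF c] using c
    by (subst scalar_prod_add_distrib[of _ R]) auto
  then show ?thesis
    by (simp add: ip_S' S'_in S_S'[OF c])
qed

lemma A_coercive: "c \<in> carrier_vec R \<Longrightarrow> c \<bullet> (A *\<^sub>v c) \<ge> \<gamma> * (c \<bullet> c)"
  using ip_nonneg[OF S'_in] by (simp add: A_quadratic_form)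

lemma A_trivial_kernel:
  assumes c: "c \<in> carrier_vec R" and "A *\<^sub>v c = 0\<^sub>v R"
  shows "c = 0\<^sub>v R"
proof -
  have "\<gamma> * (c \<bullet> c) \<le> 0"
    using A_coercive[OF c] assms by simp
  then have "(\<Sum>i<R. c $ i * c $ i) \<le> 0"
    using \<gamma>_pos c by (simp add: mult_le_0_iff scalar_prod_def atLeast0LessThan)
  then have "(\<Sum>i<R. c $ i * c $ i) = 0"
    by (intro antisym sum_nonneg) auto
  then show ?thesis
    using c by (intro eq_vecI) (auto simp: sum_nonneg_eq_0_iff)
qed

lemma A_inv_carrier: "mat_inv A \<in> carrier_mat R R"
  using mat_inv_carrier[OF matrix_carrier(2)] A_trivial_kernel by blast

lemma A_invertible: "invertible_mat A"
  using invertible_mat_if_trivial_kernel[OF matrix_carrier(2)] A_trivial_kernel by blast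

lemma A_inv_dim [simp]: "dim_row (mat_inv A) = R" "dim_col (mat_inv A) = R"
  using carrier_matD[OF A_inv_carrier] .

lemma A_inv_mult_carrier [simp]: "mat_inv A *\<^sub>v z \<in> carrier_vec R"
  by (simp add: carrier_vecI)

lemma A_A_inv:
  assumes "z \<in> carrier_vec R"
  shows "A *\<^sub>v (mat_inv A *\<^sub>v z) = z"
proof -
  have "A *\<^sub>v (mat_inv A *\<^sub>v z) = (A * mat_inv A) *\<^sub>v z"
    using assms A_inv_carrier matrix_carrier(2) by (metis assoc_mult_mat_vec)
  then show ?thesis
    using assms by (simp add: mult_mat_inv[OF matrix_carrier(2) A_trivial_kernel])
qed

lemma T_in: "u \<in> H \<Longrightarrow> T u \<in> H"
  by (intro subspace_add[OF subspace] subspace_scale[OF subspace] S'_in)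

text \<open>The push-through identity (S' S + \<gamma> I) S' = S' (S S' + \<gamma> I), which moves
  the inversion from \<open>H\<close> to a finite matrix.\<close>

lemma T_S': "c \<in> carrier_vec R \<Longrightarrow> T (S' c) = S' (A *\<^sub>v c)"
  by (simp add: S_S' A_mult S'_add S'_scale)

text \<open>A difference \<open>w\<close> with \<open>T w = 0\<close> satisfies 0 = ip (T w) w = |S
  w|^2 + \<gamma> ip w w, which is positive unless \<open>w = 0\<close>.\<close>

lemma T_inj: "inj_on T H"
proof (rule inj_onI, rule ccontr)
  fix u v assume u: "u \<in> H" and v: "v \<in> H" and eq: "T u = T v" and "u \<noteq> v"
  define w where "w = u - v"
  have w: "w \<in> H" "w \<noteq> 0"
    using u v \<open>u \<noteq> v\<close> subspace_diff[OF subspace] by (auto simp: w_def)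
  have u_eq: "u = v + w" by (simp add: w_def)
  have "T w = 0"
    using eq by (simp add: u_eq S_add S'_add scaleR_right_distrib)
  then have "ip (S' (S w)) w + \<gamma> * ip w w = 0"
    using w ip_zero_left S'_in subspace_scale[OF subspace]
    by (metis ip_add_left ip_scale_left)
  moreover have "S w \<bullet> S w \<ge> 0"
    by (simp add: scalar_prod_def sum_nonneg)
  ultimately show False
    using ip_pos[OF w] \<gamma>_pos w by (simp add: ip_S' add_nonneg_eq_0_iff)
qed

lemma T_surj:
  assumes "v \<in> H"
  shows "\<exists>u\<in>H. T u = v"
proof
  \<comment> \<open>Solving \<open>T u = v\<close> for \<open>u\<close> gives u = (v - S' (S u)) /
    \<gamma>. Applying \<open>S\<close> turns this into A (S u) = S v, so \<open>?a\<close> is the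
    only candidate for \<open>S u\<close>; the check below confirms it.\<close>
  let ?a = "mat_inv A *\<^sub>v S v"
  let ?u = "(1 / \<gamma>) *\<^sub>R (v - S' ?a)"
  show "?u \<in> H"
    using assms by (intro subspace_scale[OF subspace] subspace_diff[OF subspace] S'_in)
  have "S v = G *\<^sub>v ?a + \<gamma> \<cdot>\<^sub>v ?a"
    using A_A_inv[of "S v"] A_mult[OF A_inv_mult_carrier, of "S v"] by simp
  then have "S ?u = (1 / \<gamma>) \<cdot>\<^sub>v (G *\<^sub>v ?a + \<gamma> \<cdot>\<^sub>v ?a - G *\<^sub>v ?a)"
    by (simp add: S_scale S_diff S_S')
  also have "\<dots> = ?a"
    using \<gamma>_pos by (intro eq_vecI) auto
  finally show "T ?u = v"
    using \<gamma>_pos by simp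
qed

lemma T_bij: "bij_betw T H H"
  using T_inj T_in T_surj by (fastforce simp: bij_betw_def)

lemma the_inv_T: "z \<in> carrier_vec R \<Longrightarrow> the_inv_into H T (S' z) = S' (mat_inv A *\<^sub>v z)"
  using the_inv_into_f_f[OF T_inj S'_in, of "mat_inv A *\<^sub>v z"]
  by (simp only: T_S'[OF A_inv_mult_carrier] A_A_inv)

abbreviation "objective z u \<equiv> (S u - z) \<bullet> (S u - z) + \<gamma> * ip u u"

text \<open>Completing the square about \<open>u = S' A\<^sup>-\<^sup>1 z\<close>.\<close>

lemma objective_eq:
  assumes z: "z \<in> carrier_vec R" and h: "h \<in> H"
  shows "objective z (S' (mat_inv A *\<^sub>v z) + h) =
    \<gamma> * (z \<bullet> (mat_inv A *\<^sub>v z)) + S h \<bullet> S h + \<gamma> * ip h h"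
proof -
  define a where "a = mat_inv A *\<^sub>v z"
  have a: "a \<in> carrier_vec R" by (simp add: a_def)
  have Aa: "A *\<^sub>v a = z" unfolding a_def by (rule A_A_inv[OF z])
  then have z_eq: "z = G *\<^sub>v a + \<gamma> \<cdot>\<^sub>v a"
    using A_mult[OF a] by simp
  have dims: "dim_vec a = R" "dim_vec (G *\<^sub>v a) = R"
    using a by (auto simp: op_matrix_def)
  \<comment> \<open>As z = G a + \<gamma> a and S S' a = G a, only \<gamma> a remains of the
    residual at \<open>S' a\<close>. The cross terms of residual and penalty, -2 \<gamma> a . S h
    and +2 \<gamma> a . S h, cancel in the sum.\<close>
  have "S (S' a + h) - z = S h - \<gamma> \<cdot>\<^sub>v a"
    unfolding z_eq S_add S_S'[OF a] by (intro eq_vecI) (simp_all add: dims)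
  moreover have "(S h - \<gamma> \<cdot>\<^sub>v a) \<bullet> (S h - \<gamma> \<cdot>\<^sub>v a) = S h \<bullet> S h - 2 * \<gamma> * (a \<bullet> S h) + \<gamma>\<^sup>2 * (a \<bullet> a)"
    by (simp add: scalar_prod_def dims algebra_simps power2_eq_square sum.distrib
        sum_subtractf sum_distrib_left)
  moreover have "ip (S' a + h) (S' a + h) = ip (S' a) (S' a) + 2 * (a \<bullet> S h) + ip h h"
    using h S'_in[of a] subspace_add[OF subspace]
    by (simp add: ip_add_left ip_add_right ip_sym[of h "S' a"] ip_S')
  moreover have "z \<bullet> a = ip (S' a) (S' a) + \<gamma> * (a \<bullet> a)"
    using A_quadratic_form[OF a] comm_scalar_prod[OF z a] Aa by simp
  ultimately show ?thesis
    unfolding a_def[symmetric] by (simp add: algebra_simps power2_eq_square)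
qed

lemma objective_at_minimizer:
  assumes "z \<in> carrier_vec R"
  shows "objective z (S' (mat_inv A *\<^sub>v z)) = \<gamma> * (z \<bullet> (mat_inv A *\<^sub>v z))"
proof -
  have "S 0 \<bullet> S 0 = 0" by (simp add: pairing_vec_def scalar_prod_def)
  then show ?thesis
    using objective_eq[OF assms subspace_0[OF subspace]] subspace_0[OF subspace]
    by (simp add: ip_zero_left)
qed

lemma objective_ge:
  assumes "z \<in> carrier_vec R" "u \<in> H"
  shows "objective z u \<ge> \<gamma> * (z \<bullet> (mat_inv A *\<^sub>v z))"
proof -
  let ?h = "u - S' (mat_inv A *\<^sub>v z)"
  have h: "?h \<in> H" using assms(2) S'_in by (rule subspace_diff[OF subspace])
  have "S ?h \<bullet> S ?h \<ge> 0" by (simp add: scalar_prod_def sum_nonneg)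
  then show ?thesis
    using objective_eq[OF assms(1) h] ip_nonneg[OF h] \<gamma>_pos by simp
qed

text \<open>Minimization over \<open>u\<close> first: each fixed \<open>z'\<close> contributes at
  least \<gamma> z'^T A^-1 z', and this bound is attained at S' A^-1 z', so minimizing the bound
  over feasible vectors solves the joint problem.\<close>

lemma joint_solution_if_reduced:
  assumes feas: "\<And>z. feasible z \<Longrightarrow> z \<in> carrier_vec R"
    and min: "is_arg_min (\<lambda>z. z \<bullet> (mat_inv A *\<^sub>v z)) feasible z"
  shows "is_arg_min (\<lambda>(z, u). objective z u) (\<lambda>(z, u). feasible z \<and> u \<in> H)
    (z, the_inv_into H T (S' z))"
proof -
  have z: "feasible z" "z \<in> carrier_vec R"
    using min feas by (auto simp: is_arg_min_def)
  have "objective z (S' (mat_inv A *\<^sub>v z)) \<le> objective z' u" if "feasible z'" "u \<in> H" for z' u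
  proof -
    have "z \<bullet> (mat_inv A *\<^sub>v z) \<le> z' \<bullet> (mat_inv A *\<^sub>v z')"
      using min that by (auto simp: is_arg_min_def not_less)
    then show ?thesis
      using objective_ge[OF feas that(2)] that(1) objective_at_minimizer[OF z(2)] \<gamma>_pos
      by (smt (verit) mult_left_mono)
  qed
  then show ?thesis
    using z S'_in by (fastforce simp: is_arg_min_def the_inv_T not_less)
qed

text \<open>
  With \<open>z = A c\<close> the objective becomes \<open>c\<^sup>T A c \<ge> \<gamma> |c|\<^sup>2\<close>, so its sublevel sets lie in boxes.
\<close>

lemma reduced_solution_exists:
  assumes feas: "\<And>z. feasible z \<Longrightarrow> z \<in> carrier_vec R"
    and closed: "closed {a :: nat \<Rightarrow> real. feasible (Matrix.vec R a)}"
    and ex: "feasible z\<^sub>0"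
  shows "\<exists>z. is_arg_min (\<lambda>z. z \<bullet> (mat_inv A *\<^sub>v z)) feasible z"
proof -
  define val where "val a = Matrix.vec R a \<bullet> (A *\<^sub>v Matrix.vec R a)" for a :: "nat \<Rightarrow> real"
  \<comment> \<open>The coordinates of c = A^-1 z as an infinite sequence. The default 0 from
    position \<open>R\<close> on places it in the box below, whose tail factors are
    \<open>{0}\<close>.\<close>
  define coords where "coords z i = (if i < R then (mat_inv A *\<^sub>v z) $ i else 0)" for z i
  define img where "img a i = (if i < R then \<Sum>j<R. A $$ (i, j) * a j else 0)" for a :: "nat \<Rightarrow> real" and i
  define Z where "Z = {a :: nat \<Rightarrow> real. feasible (A *\<^sub>v Matrix.vec R a)}"
  \<comment> \<open>From \<gamma> c_i^2 \<le> c^T A c, every coordinate of a point at least as good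
    as the known feasible one is at most \<open>b\<close> in absolute value.\<close>
  define b where "b = sqrt (val (coords z\<^sub>0) / \<gamma>)"
  define box where "box = Pi\<^sub>E UNIV (\<lambda>i::nat. if i < R then {-b..b} else {0})"
  have vec_coords: "Matrix.vec R (coords z) = mat_inv A *\<^sub>v z" for z
    by (intro eq_vecI) (simp_all add: coords_def)
  have val_coords: "val (coords z) = z \<bullet> (mat_inv A *\<^sub>v z)" if "z \<in> carrier_vec R" for z
    unfolding val_def vec_coords A_A_inv[OF that] using that by (intro comm_scalar_prod[of _ R]) auto
  have A_vec: "Matrix.vec R (img a) = A *\<^sub>v Matrix.vec R a" for a
    by (intro eq_vecI) (auto simp: img_def scalar_prod_def atLeast0LessThan intro!: sum.cong)
  have cont_coord: "continuous_on UNIV (\<lambda>a. img a i)" for i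
    unfolding img_def
    by (cases "i < R") (auto intro!: continuous_intros continuous_on_product_coordinates)
  then have "continuous_on UNIV img"
    by (rule continuous_on_coordinatewise_then_product)
  \<comment> \<open>\<open>img\<close> is c \<mapsto> A c in coordinates, so closedness of the
    feasible set pulls back to the variable \<open>c\<close>.\<close>
  moreover have "Z = img -` {a. feasible (Matrix.vec R a)}"
    by (simp add: Z_def flip: A_vec)
  ultimately have "closed Z"
    using closed_vimage[OF closed] by metis
  have val_eq: "val = (\<lambda>a. \<Sum>i<R. a i * img a i)"
    unfolding val_def A_vec[symmetric] by (simp add: scalar_prod_def atLeast0LessThan)
  have cont_val: "continuous_on UNIV val"
    unfolding val_eq by (intro continuous_intros cont_coord continuous_on_product_coordinates)
  \<comment> \<open>Tychonoff: each factor is a compact interval or a singleton.\<close>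
  have "compact box"
    unfolding box_def compactin_euclidean_iff[symmetric] euclidean_product_topology[symmetric]
    by (subst compactin_PiE) auto
  then have "compact (box \<inter> Z)" using \<open>closed Z\<close> by (rule compact_Int_closed)
  have in_box: "coords z \<in> box" if "val (coords z) \<le> val (coords z\<^sub>0)" for z
  proof -
    have bound: "\<bar>coords z i\<bar> \<le> b" if i: "i < R" for i
    proof -
      have "(coords z i)\<^sup>2 \<le> (\<Sum>k<R. (coords z k)\<^sup>2)"
        using i by (intro member_le_sum) auto
      also have "\<dots> = Matrix.vec R (coords z) \<bullet> Matrix.vec R (coords z)"
        by (simp add: scalar_prod_def atLeast0LessThan power2_eq_square)
      also have "\<gamma> * \<dots> \<le> val (coords z)"
        unfolding val_def by (rule A_coercive) simp
      finally have "\<gamma> * (coords z i)\<^sup>2 \<le> val (coords z\<^sub>0)"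
        using \<gamma>_pos \<open>val (coords z) \<le> val (coords z\<^sub>0)\<close> by simp
      then have "(coords z i)\<^sup>2 \<le> val (coords z\<^sub>0) / \<gamma>"
        using \<gamma>_pos by (simp add: field_simps)
      then show ?thesis
        unfolding b_def using real_le_rsqrt[of "\<bar>coords z i\<bar>"] by simp
    qed
    have "coords z i \<in> (if i < R then {-b..b} else {0})" for i
    proof (cases "i < R")
      case True
      with bound[OF True] show ?thesis by (auto simp: abs_le_iff)
    next
      case False
      then show ?thesis by (simp add: coords_def)
    qed
    then show ?thesis
      unfolding box_def by (intro PiE_I) (simp_all only: UNIV_I not_True_eq_False)
  qed
  have in_Z: "coords z \<in> Z" if "feasible z" for z
    using that feas by (simp add: Z_def vec_coords A_A_inv)
  have "coords z\<^sub>0 \<in> box \<inter> Z" using in_box in_Z ex by simp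
  with continuous_attains_inf[OF \<open>compact (box \<inter> Z)\<close>, of val] obtain a
    where a: "a \<in> box \<inter> Z" "\<forall>c\<in>box \<inter> Z. val a \<le> val c"
    using continuous_on_subset[OF cont_val] by blast
  let ?z = "A *\<^sub>v Matrix.vec R a"
  have z: "feasible ?z" using a(1) by (simp add: Z_def)
  have "mat_inv A *\<^sub>v ?z = (mat_inv A * A) *\<^sub>v Matrix.vec R a"
    using A_inv_carrier matrix_carrier(2) by (metis assoc_mult_mat_vec vec_carrier)
  then have "mat_inv A *\<^sub>v ?z = Matrix.vec R a"
    by (simp add: mat_inv_mult[OF matrix_carrier(2) A_trivial_kernel])
  then have "?z \<bullet> (mat_inv A *\<^sub>v ?z) = val a"
    unfolding val_def using comm_scalar_prod[OF feas[OF z], of "Matrix.vec R a"] by simp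
  \<comment> \<open>Feasible vectors worse than the known one may leave the box, but their value
    already exceeds a value that \<open>a\<close> does not exceed.\<close>
  moreover have "val a \<le> val (coords z')" if "feasible z'" for z'
  proof (cases "val (coords z') \<le> val (coords z\<^sub>0)")
    case True
    then show ?thesis using a(2) in_box in_Z that by blast
  next
    case False
    moreover have "val a \<le> val (coords z\<^sub>0)" using a(2) \<open>coords z\<^sub>0 \<in> box \<inter> Z\<close> by blast
    ultimately show ?thesis by simp
  qed
  ultimately show ?thesis
    using z feas val_coords by (intro exI[of _ ?z]) (auto simp: is_arg_min_def not_less)
qed

end

section \<open>Indexing, closedness of the constraint and feasibility of the exact solution\<close>

lemma index_pairs_eq:
  "index_pairs Db D n\<^sub>\<Omega> n =
     List.product [1..<Db + 1] [n\<^sub>\<Omega> + 1..<n + 1] @ List.product [Db + 1..<D + 1] [1..<n\<^sub>\<Omega> + 1]"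
  by (simp only: index_pairs_def product_concat_map)

lemma distinct_index_pairs: "distinct (index_pairs Db D n\<^sub>\<Omega> n)"
  by (auto simp: index_pairs_eq distinct_product)

lemma length_index_pairs: "length (index_pairs Db D n\<^sub>\<Omega> n) = (n - n\<^sub>\<Omega>) * Db + n\<^sub>\<Omega> * (D - Db)"
  by (simp only: index_pairs_eq length_append length_product length_upt) simp

lemma set_index_pairs:
  "(i, j) \<in> set (index_pairs Db D n\<^sub>\<Omega> n) \<longleftrightarrow>
     1 \<le> i \<and> i \<le> Db \<and> n\<^sub>\<Omega> < j \<and> j \<le> n \<or> Db < i \<and> i \<le> D \<and> 1 \<le> j \<and> j \<le> n\<^sub>\<Omega>"
  by (auto simp: index_pairs_eq)

lemma component_vec:
  assumes "distinct idx" "(i, j) \<in> set idx"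
  obtains k where "k < length idx" "idx ! k = (i, j)" "\<And>z. component idx z i j = z $ k"
proof -
  obtain k where k: "k < length idx" "idx ! k = (i, j)"
    using assms(2) by (auto simp: in_set_conv_nth)
  have "(THE k. k < length idx \<and> idx ! k = (i, j)) = k"
    using k assms(1) by (metis (mono_tags, lifting) nth_eq_iff_index_eq the_equality)
  then show ?thesis
    using that k by (simp add: component_def)
qed

text \<open>Each entry of \<open>component_values\<close> is a single coordinate of
  \<open>a\<close>, so the function is \<open>G\<close> composed with a selection of coordinates,
  continuous in the product topology.\<close>

lemma continuous_on_component_values:
  assumes G: "continuous_on_vecs (hi - lo) G" and idx: "distinct idx"
    and sub: "\<And>i. lo < i \<Longrightarrow> i \<le> hi \<Longrightarrow> (i, j) \<in> set idx"
  shows "continuous_on UNIV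
    (\<lambda>a. G (component_values idx lo hi (Matrix.vec (length idx) a) j))"
proof -
  \<comment> \<open>Padding with 0 makes the selection a full sequence, the kind of argument for
    which \<open>continuous_on_vecs\<close> is stated.\<close>
  define h :: "(nat \<Rightarrow> real) \<Rightarrow> nat \<Rightarrow> real" where
    "h a l = (if l < hi - lo then component idx (Matrix.vec (length idx) a) (lo + 1 + l) j else 0)" for a l
  have "continuous_on UNIV (\<lambda>a. h a l)" for l
  proof (cases "l < hi - lo")
    case True
    then have "(lo + 1 + l, j) \<in> set idx" by (intro sub) auto
    then obtain k where "k < length idx" "\<And>z. component idx z (lo + 1 + l) j = z $ k"
      using component_vec[OF idx] by metis
    with True have eq: "(\<lambda>a. h a l) = (\<lambda>a. a k)" by (simp add: h_def)
    show ?thesis unfolding eq by (rule continuous_on_product_coordinates)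
  qed (simp add: h_def)
  then have "continuous_on UNIV h" by (rule continuous_on_coordinatewise_then_product)
  then have "continuous_on UNIV (\<lambda>a. G (Matrix.vec (hi - lo) (h a)))"
    by (rule continuous_on_compose2[OF G[unfolded continuous_on_vecs_def] _ subset_UNIV])
  moreover have "component_values idx lo hi (Matrix.vec (length idx) a) j = Matrix.vec (hi - lo) (h a)" for a
    by (intro eq_vecI) (simp_all add: component_values_def h_def)
  ultimately show ?thesis by simp
qed

lemma closed_constraint_set:
  assumes "continuous_on_vecs (D - Db) P" "continuous_on_vecs Db B"
  shows "closed {a. constraint_map Db D n\<^sub>\<Omega> n P B
    (Matrix.vec (length (index_pairs Db D n\<^sub>\<Omega> n)) a) = y}"
proof -
  define F where "F a = constraint_map Db D n\<^sub>\<Omega> n P B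
    (Matrix.vec (length (index_pairs Db D n\<^sub>\<Omega> n)) a)" for a
  \<comment> \<open>Entry \<open>k\<close> belongs to point number \<open>k + 1\<close>, so
    \<open>k < n\<^sub>\<Omega>\<close> selects exactly the interior points.\<close>
  have "continuous_on UNIV (\<lambda>a. F a $ k)" if k: "k < n" for k
  proof (cases "k < n\<^sub>\<Omega>")
    case True
    then show ?thesis
      using assms(1) k unfolding F_def constraint_map_def
      by (simp add: Let_def)
        (intro continuous_on_component_values distinct_index_pairs, auto simp: set_index_pairs)
  next
    case False
    then show ?thesis
      using assms(2) k unfolding F_def constraint_map_def
      by (simp add: Let_def)
        (intro continuous_on_component_values distinct_index_pairs, auto simp: set_index_pairs)
  qed
  then have "closed (\<Inter>k\<in>{..<n}. {a. F a $ k = y $ k})"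
    by (intro closed_INT ballI closed_Collect_eq) auto
  \<comment> \<open>Vectors of different dimension are never equal, so the set is empty unless
    \<open>y\<close> has \<open>n\<close> entries.\<close>
  moreover have "{a. F a = y} = (if dim_vec y = n then \<Inter>k\<in>{..<n}. {a. F a $ k = y $ k} else {})"
    by (auto simp: F_def constraint_map_def Let_def vec_eq_iff)
  ultimately show ?thesis
    unfolding F_def by (simp split: if_splits)
qed

text \<open>The singleton of \<open>p\<close> is a compact subset of \<open>S\<close>, so the local
  bound in \<open>bounded_op_into_C\<close> bounds the evaluation at \<open>p\<close>.\<close>

lemma bounded_linear_point_evaluation:
  assumes T: "bounded_op_into_C S T" and p: "p \<in> S"
  shows "bounded_linear (\<lambda>u. T u p)"
proof -
  obtain C where "\<And>u. \<bar>T u p\<bar> \<le> C * norm u"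
    using assms unfolding bounded_op_into_C_def by (metis compact_sing empty_subsetI insert_subset singletonI)
  then show ?thesis
    using assms unfolding bounded_op_into_C_def
    by (intro bounded_linear_intro[of _ C]) (auto simp: mult.commute)
qed

text \<open>The sampled components of \<open>u\<close> are the values L_i u (x_j), so each entry of
  the constraint is the equation or the boundary condition at one sample point. This supplies a
  feasible vector.\<close>

lemma constraint_map_strong_solution:
  assumes sol: "strong_solution \<Omega> L Db D P B f g u"
    and boundary: "\<And>i. 1 \<le> i \<Longrightarrow> i \<le> Db \<Longrightarrow> bounded_op_into_C (frontier \<Omega>) (L i)"
    and interior: "\<And>i. Db < i \<Longrightarrow> i \<le> D \<Longrightarrow> bounded_op_into_C \<Omega> (L i)"
    and x: "\<And>j. 1 \<le> j \<Longrightarrow> j \<le> n\<^sub>\<Omega> \<Longrightarrow> x j \<in> \<Omega>" "\<And>j. n\<^sub>\<Omega> < j \<Longrightarrow> j \<le> n \<Longrightarrow> x j \<in> frontier \<Omega>"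
  shows "constraint_map Db D n\<^sub>\<Omega> n P B (pairing_vec (functionals L x (index_pairs Db D n\<^sub>\<Omega> n)) u) =
    data_vec f g x n\<^sub>\<Omega> n"
proof -
  define idx where "idx = index_pairs Db D n\<^sub>\<Omega> n"
  define z where "z = pairing_vec (functionals L x idx) u"
  have comp: "component idx z i j = L i u (x j)" if ij: "(i, j) \<in> set idx" for i j
  proof -
    obtain k where k: "k < length idx" "idx ! k = (i, j)" "component idx z i j = z $ k"
      using component_vec[OF distinct_index_pairs, of i j Db D n\<^sub>\<Omega> n] ij unfolding idx_def by metis
    \<comment> \<open>\<open>Blinfun\<close> returns the intended functional only for bounded linear
      arguments.\<close>
    have "bounded_linear (\<lambda>u. L i u (x j))"
      using ij boundary interior x unfolding idx_def set_index_pairs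
      by (metis bounded_linear_point_evaluation)
    then show ?thesis
      using k by (simp add: z_def pairing_vec_def functionals_def bounded_linear_Blinfun_apply)
  qed
  have "component_values idx Db D z j = op_values L Db D u (x j)" if "1 \<le> j" "j \<le> n\<^sub>\<Omega>" for j
    using that by (intro eq_vecI)
      (auto simp: component_values_def op_values_def idx_def set_index_pairs intro!: comp[unfolded idx_def])
  moreover have "component_values idx 0 Db z j = op_values L 0 Db u (x j)" if "n\<^sub>\<Omega> < j" "j \<le> n" for j
    using that by (intro eq_vecI)
      (auto simp: component_values_def op_values_def idx_def set_index_pairs intro!: comp[unfolded idx_def])
  ultimately show ?thesis
    using sol x unfolding idx_def[symmetric] z_def[symmetric]
    by (intro eq_vecI)
      (auto simp: constraint_map_def data_vec_def strong_solution_def Let_def simp flip: idx_def)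
qed

section \<open>Reduction of the optimization problem to a finite-dimensional one\<close>

theorem theorem3p4:
  fixes \<Omega> :: "'a::euclidean_space set"
    and ev :: "'u::banach \<Rightarrow> 'a \<Rightarrow> real"
    and K :: "('u \<Rightarrow>\<^sub>L real) \<Rightarrow> 'u"
    and L :: "nat \<Rightarrow> 'u \<Rightarrow> 'a \<Rightarrow> real"
    and D\<^sub>b D M\<^sub>\<Omega> M N\<^sub>\<Omega> N :: nat
    and P B :: "real Matrix.vec \<Rightarrow> real"
    and f g :: "'a \<Rightarrow> real"
    and xh x :: "nat \<Rightarrow> 'a"
    and U\<^sub>Q :: "'u set"
    and ip\<^sub>Q :: "'u \<Rightarrow> 'u \<Rightarrow> real"
    and \<gamma> :: real
  assumes domain: "open \<Omega>" "connected \<Omega>" "bounded \<Omega>" "\<Omega> \<noteq> {}"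
    and space: "function_space (closure \<Omega>) ev"
    and K_linear: "linear K" and K_bij: "bij K"
    and K_sym: "\<And>\<phi> \<phi>'. blinfun_apply \<phi> (K \<phi>') = blinfun_apply \<phi>' (K \<phi>)"
    and K_pos: "\<And>\<phi>. \<phi> \<noteq> 0 \<Longrightarrow> blinfun_apply \<phi> (K \<phi>) > 0"
    and norm_K: "\<And>u. (norm u)\<^sup>2 = blinfun_apply (the_inv K u) u"
    and D\<^sub>b: "1 \<le> D\<^sub>b" "D\<^sub>b \<le> D"
    and L_boundary: "\<And>i. 1 \<le> i \<Longrightarrow> i \<le> D\<^sub>b \<Longrightarrow> bounded_op_into_C (frontier \<Omega>) (L i)"
    and L_interior: "\<And>i. D\<^sub>b < i \<Longrightarrow> i \<le> D \<Longrightarrow> bounded_op_into_C \<Omega> (L i)"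
    and pde: "\<exists>!u. strong_solution \<Omega> L D\<^sub>b D P B f g u"
    and inducing: "M\<^sub>\<Omega> \<le> M"
      "\<And>j. 1 \<le> j \<Longrightarrow> j \<le> M\<^sub>\<Omega> \<Longrightarrow> xh j \<in> \<Omega>"
      "\<And>j. M\<^sub>\<Omega> < j \<Longrightarrow> j \<le> M \<Longrightarrow> xh j \<in> frontier \<Omega>"
    and samples: "N\<^sub>\<Omega> \<le> N"
      "\<And>j. 1 \<le> j \<Longrightarrow> j \<le> N\<^sub>\<Omega> \<Longrightarrow> x j \<in> \<Omega>"
      "\<And>j. N\<^sub>\<Omega> < j \<Longrightarrow> j \<le> N \<Longrightarrow> x j \<in> frontier \<Omega>"
  defines "\<Phi> \<equiv> functionals L xh (index_pairs D\<^sub>b D M\<^sub>\<Omega> M)"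
  assumes \<Phi>_indep: "lin_indep_list \<Phi>"
  defines "Q \<equiv> inducing_operator K \<Phi>"
  defines "\<delta> \<equiv> (\<lambda>p. Blinfun (\<lambda>u. ev u p))"
  assumes U\<^sub>Q: "is_rkhs ev (closure \<Omega>) (\<lambda>p p'. blinfun_apply (\<delta> p) (Q (\<delta> p'))) U\<^sub>Q ip\<^sub>Q"
  defines "\<psi> \<equiv> functionals L x (index_pairs D\<^sub>b D N\<^sub>\<Omega> N)"
    and "R \<equiv> (N - N\<^sub>\<Omega>) * D\<^sub>b + N\<^sub>\<Omega> * (D - D\<^sub>b)"
    and "F \<equiv> constraint_map D\<^sub>b D N\<^sub>\<Omega> N P B"
    and "y \<equiv> data_vec f g x N\<^sub>\<Omega> N"
  defines "S \<equiv> pairing_vec \<psi>"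
  defines "S' \<equiv> adjoint_on U\<^sub>Q ip\<^sub>Q S"
  defines "A \<equiv> op_matrix Q \<psi> \<psi> + \<gamma> \<cdot>\<^sub>m 1\<^sub>m R"
    and "T \<equiv> (\<lambda>u. S' (S u) + \<gamma> *\<^sub>R u)"
  defines "reduced_solution \<equiv>
      is_arg_min (\<lambda>z. z \<bullet> (mat_inv A *\<^sub>v z)) (\<lambda>z. z \<in> carrier_vec R \<and> F z = y)"
    and "joint_solution \<equiv>
      is_arg_min (\<lambda>(z, u). (pairing_vec \<psi> u - z) \<bullet> (pairing_vec \<psi> u - z) + \<gamma> * ip\<^sub>Q u u)
        (\<lambda>(z, u). z \<in> carrier_vec R \<and> u \<in> U\<^sub>Q \<and> F z = y)"
  assumes \<gamma>: "\<gamma> > 0"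
  shows "invertible_mat A \<and> bij_betw T U\<^sub>Q U\<^sub>Q \<and>
    (\<forall>z. reduced_solution z \<longrightarrow> joint_solution (z, the_inv_into U\<^sub>Q T (S' z))) \<and>
    (continuous_on_vecs (D - D\<^sub>b) P \<and> continuous_on_vecs D\<^sub>b B \<longrightarrow> (\<exists>z. reduced_solution z))"
proof -
  interpret inducing K \<Phi>
    using K_linear bij_is_surj[OF K_bij] K_sym K_pos \<Phi>_indep by (intro inducing.intro)
  note rkhs = U\<^sub>Q[unfolded \<delta>_def Q_def]
  interpret ridge U\<^sub>Q ip\<^sub>Q \<psi> Q \<gamma>
  proof
    show "subspace U\<^sub>Q" "complete_inner_product_on U\<^sub>Q ip\<^sub>Q"
      using U\<^sub>Q by (auto simp: is_rkhs_def)
    show "Q \<phi> \<in> U\<^sub>Q" for \<phi>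
      unfolding Q_def by (rule inducing_operator_in_rkhs[OF space rkhs])
    show "ip\<^sub>Q u (Q \<phi>) = blinfun_apply \<phi> u" if "u \<in> U\<^sub>Q" for u \<phi>
      unfolding Q_def by (rule inducing_operator_reproducing[OF space rkhs that])
  qed (rule \<gamma>)
  \<comment> \<open>Counting the index pairs identifies the explicit dimension formula with the
    length of the functional list.\<close>
  have R: "R = length \<psi>"
    by (simp add: R_def \<psi>_def functionals_def length_index_pairs)
  have A: "A = op_matrix Q \<psi> \<psi> + \<gamma> \<cdot>\<^sub>m 1\<^sub>m (length \<psi>)"
    by (simp add: A_def R)
  let ?feasible = "\<lambda>z. z \<in> carrier_vec R \<and> F z = y"
  have "joint_solution (z, the_inv_into U\<^sub>Q T (S' z))" if "reduced_solution z" for z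
  proof -
    have "is_arg_min (\<lambda>(z, u). (pairing_vec \<psi> u - z) \<bullet> (pairing_vec \<psi> u - z) + \<gamma> * ip\<^sub>Q u u)
        (\<lambda>(z, u). ?feasible z \<and> u \<in> U\<^sub>Q) (z, the_inv_into U\<^sub>Q T (S' z))"
      unfolding T_def S'_def S_def
      by (rule joint_solution_if_reduced)
        (use that in \<open>simp_all add: reduced_solution_def A R\<close>)
    then show ?thesis
      by (simp add: joint_solution_def is_arg_min_def conj_ac)
  qed
  moreover have "\<exists>z. reduced_solution z"
    if "continuous_on_vecs (D - D\<^sub>b) P" "continuous_on_vecs D\<^sub>b B"
  proof -
    obtain u where u: "strong_solution \<Omega> L D\<^sub>b D P B f g u" using pde by blast
    \<comment> \<open>The pairing is defined on the whole space, so the exact solution yields a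
      feasible vector even when it lies outside \<open>U\<^sub>Q\<close>.\<close>
    have "F (S u) = y"
      unfolding F_def y_def S_def \<psi>_def
      by (rule constraint_map_strong_solution[OF u L_boundary L_interior samples(2,3)])
    moreover have "S u \<in> carrier_vec R"
      unfolding S_def R by (rule S_carrier(1))
    moreover have "closed {a. ?feasible (Matrix.vec (length \<psi>) a)}"
      using closed_constraint_set[OF that, of N\<^sub>\<Omega> N y]
      by (simp add: F_def R \<psi>_def functionals_def)
    ultimately show ?thesis
      unfolding reduced_solution_def A
      by (intro reduced_solution_exists[of ?feasible "S u"]) (simp_all add: R)
  qed
  ultimately show ?thesis
    using A_invertible T_bij unfolding A T_def S'_def S_def by blast
qed

end
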